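(* Let $X$ and $Y$ be normed spaces and let $f:X\to Y$ be a mapping. Then $f$ satisfies $$f(3x+y+z)+f(x+3y+z)+f(x+y+3z)+f(x)+f(y)+f(z)=6f(x+y+z)\quad\text{for all }x,y,z\in X$$ if and only if $f$ is an affine mapping, i.e., $f$ is the sum of a constant and an additive function.
   Context: A function $a:X\to Y$ is additive if $a(u+v)=a(u)+a(v)$ for all $u,v\in X$. A mapping $f:X\to Y$ is called affine if there are a constant $c\in Y$ and an additive function $a:X\to Y$ with $f(x)=a(x)+c$ for all $x\in X$ (no continuity or homogeneity is required). *)

theory Defs
  imports Complex_Main
begin

definition affine_mapping :: "('a::real_vector \<Rightarrow> 'b::real_vector) \<Rightarrow> bool" where
  "affine_mapping f \<longleftrightarrow> (\<exists>c a. Modules.additive a \<and> (\<forall>x. f x = a x + c))"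

end

theory Submission
  imports Defs
begin

text \<open>
  With \<open>s = x + y + z\<close> the equation says that \<open>h\<^sub>s(x) = f (s + 2x) + f x\<close> satisfies
  \<open>h\<^sub>s(x) + h\<^sub>s(y) + h\<^sub>s(z) = 6 f s\<close>; hence \<open>h\<^sub>s(x) + h\<^sub>s(y)\<close> depends only on \<open>x + y\<close>,
  so every \<open>h\<^sub>s\<close> is affine. Normalise \<open>f 0 = 0\<close> and compare \<open>h\<^sub>s\<close> with \<open>h\<^sub>0\<close>: the Cauchy
  difference \<open>D(s, u) = f (s + u) - f s - f u\<close> is biadditive. As \<open>h\<^sub>0(x) = f (2x) + f x\<close> is
  additive, \<open>0 = D(2x, 2y) + D(x, y) = 5 D(x, y)\<close>.
\<close>

lemma scaleR_3: "3 *\<^sub>R x = x + x + x"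
  for x :: "'a::real_vector"
  using scaleR_add_left[of 2 1 x] by (simp add: scaleR_2)

lemma scaleR_6: "6 *\<^sub>R x = x + x + x + x + x + x"
  for x :: "'a::real_vector"
  using scaleR_add_left[of 3 3 x] by (simp add: scaleR_3 add_ac)

lemma additive_if_functional_equation:
  fixes g :: "'a::real_vector \<Rightarrow> 'b::real_vector"
  assumes eq: "\<And>x y z. g (3 *\<^sub>R x + y + z) + g (x + 3 *\<^sub>R y + z) + g (x + y + 3 *\<^sub>R z)
            + g x + g y + g z = 6 *\<^sub>R g (x + y + z)"
    and g0: "g 0 = 0"
  shows "Modules.additive g"
proof -
  have eq': "g (s + 2 *\<^sub>R x) + g (s + 2 *\<^sub>R y) + g (s + 2 *\<^sub>R z) + g x + g y + g z = 6 *\<^sub>R g s"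
    if "s = x + y + z" for s x y z
  proof -
    have sums: "s + 2 *\<^sub>R x = 3 *\<^sub>R x + y + z" "s + 2 *\<^sub>R y = x + 3 *\<^sub>R y + z"
      "s + 2 *\<^sub>R z = x + y + 3 *\<^sub>R z"
      by (simp_all add: that scaleR_2 scaleR_3 add_ac)
    show ?thesis
      using eq[of x y z] by (simp only: sums that[symmetric])
  qed
  \<comment> \<open>The triples \<open>x, y, s - x - y\<close> and
    \<open>x + y, 0, s - x - y\<close> both sum to \<open>s\<close>; their common third entry
    cancels, and \<open>g0\<close> leaves only \<open>g s\<close> from the entry
    \<open>0\<close>.\<close>
  have h: "g (s + 2 *\<^sub>R x) + g x + (g (s + 2 *\<^sub>R y) + g y) = g (s + 2 *\<^sub>R (x + y)) + g (x + y) + g s"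
    for s x y
  proof -
    have "g (s + 2 *\<^sub>R x) + g x + (g (s + 2 *\<^sub>R y) + g y)
        + (g (s + 2 *\<^sub>R (s - x - y)) + g (s - x - y)) = 6 *\<^sub>R g s"
      using eq'[of s x y "s - x - y"] by (simp add: add_ac)
    moreover have "g (s + 2 *\<^sub>R (x + y)) + g (x + y) + g s
        + (g (s + 2 *\<^sub>R (s - x - y)) + g (s - x - y)) = 6 *\<^sub>R g s"
      using eq'[of s "x + y" 0 "s - x - y"] by (simp add: g0 add_ac)
    ultimately show ?thesis by (metis add_right_cancel)
  qed
  have h0: "g (2 *\<^sub>R (x + y)) + g (x + y) = g (2 *\<^sub>R x) + g x + (g (2 *\<^sub>R y) + g y)" for x y
    using h[of 0 x y] by (simp add: g0)
  define D where "D s u = g (s + u) - g s - g u" for s u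
  have D_commute: "D s u = D u s" for s u
    by (simp add: D_def algebra_simps)
  have D_add_right: "D s (u + v) = D s u + D s v" for s u v
  proof -
    \<comment> \<open>Halving turns the shifts \<open>2x\<close>, \<open>2y\<close> in
      \<open>h\<close> into \<open>u\<close>, \<open>v\<close>. The remainder \<open>w\<close> is
      independent of \<open>s\<close>, so it cancels in \<open>D\<close>.\<close>
    define w where "w = g ((1/2) *\<^sub>R u) + g ((1/2) *\<^sub>R v) - g ((1/2) *\<^sub>R (u + v))"
    have "g (s + (u + v)) = g (s + u) + g (s + v) + w - g s"
      using h[of s "(1/2) *\<^sub>R u" "(1/2) *\<^sub>R v"]
      by (simp add: w_def scaleR_add_right[symmetric] algebra_simps del: scaleR_add_right)
    moreover have "g (u + v) = g u + g v + w"
      using h0[of "(1/2) *\<^sub>R u" "(1/2) *\<^sub>R v"]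
      by (simp add: w_def scaleR_add_right[symmetric] algebra_simps del: scaleR_add_right)
    ultimately show ?thesis
      by (simp add: D_def algebra_simps)
  qed
  have "D x y = 0" for x y
  proof -
    have "D (2 *\<^sub>R x) (2 *\<^sub>R y) + D x y = 0"
      using h0[of x y] by (simp add: D_def algebra_simps)
    moreover have "D (2 *\<^sub>R x) (2 *\<^sub>R y) = 4 *\<^sub>R D x y"
    proof -
      \<comment> \<open>Biadditivity gives doubling as \<open>u + u\<close>; symmetry carries it to
        the left argument.\<close>
      have D2: "D s (2 *\<^sub>R u) = 2 *\<^sub>R D s u" for s u
        by (simp add: scaleR_2 D_add_right)
      show ?thesis by (simp add: D2 D_commute[of "2 *\<^sub>R x"] D_commute[of y x])
    qed
    ultimately have "(4 + 1) *\<^sub>R D x y = 0"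
      by (simp only: scaleR_add_left scaleR_one)
    then show ?thesis by simp
  qed
  then show ?thesis
    unfolding D_def by (intro Modules.additive.intro) (simp add: algebra_simps)
qed

theorem theorem3p1:
  fixes f :: "'a::real_normed_vector \<Rightarrow> 'b::real_normed_vector"
  shows "(\<forall>x y z. f (3 *\<^sub>R x + y + z) + f (x + 3 *\<^sub>R y + z) + f (x + y + 3 *\<^sub>R z)
            + f x + f y + f z = 6 *\<^sub>R f (x + y + z))
    \<longleftrightarrow> affine_mapping f"
proof
  assume eq: "\<forall>x y z. f (3 *\<^sub>R x + y + z) + f (x + 3 *\<^sub>R y + z) + f (x + y + 3 *\<^sub>R z)
            + f x + f y + f z = 6 *\<^sub>R f (x + y + z)"
  \<comment> \<open>Subtracting \<open>f 0\<close> keeps the equation: both sides lose six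
    copies.\<close>
  have "Modules.additive (\<lambda>x. f x - f 0)"
  proof (rule additive_if_functional_equation)
    fix x y z
    show "f (3 *\<^sub>R x + y + z) - f 0 + (f (x + 3 *\<^sub>R y + z) - f 0) + (f (x + y + 3 *\<^sub>R z) - f 0)
            + (f x - f 0) + (f y - f 0) + (f z - f 0) = 6 *\<^sub>R (f (x + y + z) - f 0)"
      using eq[rule_format, of x y z] scaleR_6[of "f 0"] by (simp add: algebra_simps)
  qed simp
  then show "affine_mapping f"
    unfolding affine_mapping_def by (intro exI[of _ "f 0"] exI[of _ "\<lambda>x. f x - f 0"]) simp
next
  assume "affine_mapping f"
  then obtain a c where a: "Modules.additive a" and f: "\<And>x. f x = a x + c"
    unfolding affine_mapping_def by blast
  show "\<forall>x y z. f (3 *\<^sub>R x + y + z) + f (x + 3 *\<^sub>R y + z) + f (x + y + 3 *\<^sub>R z)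
            + f x + f y + f z = 6 *\<^sub>R f (x + y + z)"
    \<comment> \<open>Since \<open>a\<close> is only additive, integer multiples are expanded into
      sums; both sides become six copies of \<open>a x + a y + a z + c\<close>.\<close>
    by (simp add: f scaleR_3 scaleR_6 additive.add[OF a] add_ac)
qed

end
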